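(* Let $X$ and $Y$ be bounded metric spaces such that, for some positive integer $m$: (i) $X$ can be isometrically embedded into $\mathbb{S}^m$, and (ii) the closed upper hemisphere $\mathbf{H}_{\geq 0}(\mathbb{S}^{m+1})$ can be isometrically embedded into $Y$. Let $\zeta_m:=\arccos\left(\frac{-1}{m+1}\right)$. Then: (1) $d_{\mathrm{GH}}(X,Y)\geq\frac{1}{2}\zeta_m$. (2) Moreover, $\operatorname{dis}(\phi)\geq\zeta_m$ for any map $\phi:Y\to X$ (not necessarily continuous).
   Context: For an integer $m\ge 0$, $\mathbb{S}^m=\{x\in\mathbb{R}^{m+1}:\|x\|=1\}$ is the unit sphere with the geodesic distance $d_{\mathbb{S}^m}(x,x')=\arccos\langle x,x'\rangle$. $\mathbf{H}_{\geq 0}(\mathbb{S}^m)=\{(x_1,\dots,x_{m+1})\in\mathbb{S}^m:x_{m+1}\ge 0\}$, with the restriction of $d_{\mathbb{S}^m}$. Isometric embeddings are distance-preserving maps. The Gromov-Hausdorff distance between bounded metric spaces $X,Y$ is $d_{\mathrm{GH}}(X,Y)=\inf d_{\mathrm{H}}(f(X),g(Y))$, the infimum being over all metric spaces $Z$ and all isometric embeddings $f:X\to Z$, $g:Y\to Z$, with $d_{\mathrm{H}}$ the Hausdorff distance in $Z$. Equivalently $d_{\mathrm{GH}}(X,Y)=\frac12\inf_R \operatorname{dis}(R)$, where $R\subseteq X\times Y$ ranges over correspondences (relations whose projections to $X$ and to $Y$ are both surjective) and $\operatorname{dis}(R)=\sup_{(x,y),(x',y')\in R}|d_X(x,x')-d_Y(y,y')|$.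 For a map $\phi:Y\to X$ of metric spaces, $\operatorname{dis}(\phi)=\sup_{y,y'\in Y}|d_Y(y,y')-d_X(\phi(y),\phi(y'))|$. *)

theory Defs
  imports "HOL-Analysis.Analysis"
begin

text \<open>
  The unit sphere of dimension \<open>m\<close> is \<open>topspace (nsphere m)\<close>: points of
  \<open>\<real>\<^sup>m\<^sup>+\<^sup>1\<close> are functions on \<open>nat\<close> that vanish outside the indices \<open>0, \<dots>, m\<close>.
\<close>

lemma unit_sphere_eq:
  "topspace (nsphere m) = {x :: nat \<Rightarrow> real. (\<Sum>i\<le>m. (x i)\<^sup>2) = 1 \<and> (\<forall>i>m. x i = 0)}"
  by (auto simp: nsphere)

definition geodesic_dist :: "nat \<Rightarrow> (nat \<Rightarrow> real) \<Rightarrow> (nat \<Rightarrow> real) \<Rightarrow> real" where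
  "geodesic_dist m x y = arccos (\<Sum>i\<le>m. x i * y i)"

text \<open>The last of the \<open>m + 1\<close> coordinates has index \<open>m\<close>.\<close>

definition upper_hemisphere :: "nat \<Rightarrow> (nat \<Rightarrow> real) set" where
  "upper_hemisphere m = {x \<in> topspace (nsphere m). x m \<ge> 0}"

definition zeta :: "nat \<Rightarrow> real" where
  "zeta m = arccos (- 1 / (real m + 1))"

definition isometric_embedding ::
    "'a set \<Rightarrow> ('a \<Rightarrow> 'a \<Rightarrow> real) \<Rightarrow> 'b set \<Rightarrow> ('b \<Rightarrow> 'b \<Rightarrow> real) \<Rightarrow> ('a \<Rightarrow> 'b) \<Rightarrow> bool" where
  "isometric_embedding X dX Z dZ f \<longleftrightarrow>
     f ` X \<subseteq> Z \<and> (\<forall>x\<in>X. \<forall>x'\<in>X. dZ (f x) (f x') = dX x x')"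

text \<open>
  Suprema and infima of distances are taken in \<open>[0, \<infinity>]\<close>, so that no side conditions are
  needed: \<open>\<Squnion>\<emptyset> = 0\<close> and \<open>\<Sqinter>\<emptyset> = \<infinity>\<close>. In particular an empty set
  is at Hausdorff distance \<open>\<infinity>\<close> from every nonempty one.
\<close>

definition hausdorff_dist :: "('a \<Rightarrow> 'a \<Rightarrow> real) \<Rightarrow> 'a set \<Rightarrow> 'a set \<Rightarrow> ennreal" where
  "hausdorff_dist d A B =
     max (SUP a\<in>A. INF b\<in>B. ennreal (d a b)) (SUP b\<in>B. INF a\<in>A. ennreal (d a b))"

text \<open>
  A definition cannot quantify over metric spaces of all types. The ambient spaces here
  have carriers in \<open>'a + 'b\<close>; the lemma \<open>gromov_hausdorff_dist_le\<close> below shows that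
  ambient spaces in any other type do not make the infimum smaller.
\<close>

definition gromov_hausdorff_dist ::
    "'a set \<Rightarrow> ('a \<Rightarrow> 'a \<Rightarrow> real) \<Rightarrow> 'b set \<Rightarrow> ('b \<Rightarrow> 'b \<Rightarrow> real) \<Rightarrow> ennreal" where
  "gromov_hausdorff_dist X dX Y dY =
     Inf {hausdorff_dist dZ (f ` X) (g ` Y) | (Z :: ('a + 'b) set) dZ f g.
            Metric_space Z dZ \<and> isometric_embedding X dX Z dZ f \<and> isometric_embedding Y dY Z dZ g}"

definition map_distortion ::
    "'b set \<Rightarrow> ('b \<Rightarrow> 'b \<Rightarrow> real) \<Rightarrow> ('a \<Rightarrow> 'a \<Rightarrow> real) \<Rightarrow> ('b \<Rightarrow> 'a) \<Rightarrow> ennreal" where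
  "map_distortion Y dY dX \<phi> =
     (SUP y\<in>Y. SUP y'\<in>Y. ennreal \<bar>dY y y' - dX (\<phi> y) (\<phi> y')\<bar>)"

lemma gromov_hausdorff_dist_le:
  fixes X :: "'a set" and Y :: "'b set" and Z :: "'c set"
  assumes Z: "Metric_space Z dZ"
    and f: "isometric_embedding X dX Z dZ f" and g: "isometric_embedding Y dY Z dZ g"
  shows "gromov_hausdorff_dist X dX Y dY \<le> hausdorff_dist dZ (f ` X) (g ` Y)"
proof -
  interpret Metric_space Z dZ by (rule Z)
  define h :: "'c \<Rightarrow> 'a + 'b" where
    "h z = (if z \<in> f ` X then Inl (inv_into X f z) else Inr (inv_into Y g z))" for z
  define W where "W = f ` X \<union> g ` Y"
  define k where "k = inv_into W h"
  define d where "d u v = dZ (k u) (k v)" for u v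
  have WZ: "W \<subseteq> Z"
    using f g by (auto simp: W_def isometric_embedding_def)
  have "inj_on h W"
  proof (rule inj_onI)
    fix z z' assume "z \<in> W" "z' \<in> W" "h z = h z'"
    then show "z = z'"
      by (auto simp: h_def W_def split: if_splits dest: inv_into_injective)
  qed
  then have kh: "k (h z) = z" if "z \<in> W" for z
    using that by (simp add: k_def)
  then have dh: "d (h z) (h z') = dZ z z'" if "z \<in> W" "z' \<in> W" for z z'
    using that by (simp add: d_def)
  have "Metric_space (h ` W) d"
  proof
    show "0 \<le> d x y" "d x y = d y x" for x y
      by (auto simp: d_def commute)
    show "d x y = 0 \<longleftrightarrow> x = y" if "x \<in> h ` W" "y \<in> h ` W" for x y
      using that WZ kh by (auto simp: dh subset_iff)
    show "d x z \<le> d x y + d y z" if "x \<in> h ` W" "y \<in> h ` W" "z \<in> h ` W" for x y z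
      using that WZ by (auto simp: dh subset_iff triangle)
  qed
  moreover have "isometric_embedding X dX (h ` W) d (h \<circ> f)"
    using f by (auto simp: isometric_embedding_def dh W_def)
  moreover have "isometric_embedding Y dY (h ` W) d (h \<circ> g)"
    using g by (auto simp: isometric_embedding_def dh W_def)
  ultimately have "gromov_hausdorff_dist X dX Y dY \<le> hausdorff_dist d ((h \<circ> f) ` X) ((h \<circ> g) ` Y)"
    unfolding gromov_hausdorff_dist_def by (intro Inf_lower) blast
  also have "\<dots> = hausdorff_dist dZ (f ` X) (g ` Y)"
    unfolding hausdorff_dist_def image_image
    by (intro arg_cong2[where f = max] SUP_cong INF_cong refl) (auto simp: dh W_def)
  finally show ?thesis .
qed

end

theory Submission
  imports Defs "HOL-Homology.Homology"
begin

text \<open>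
  Both claims reduce to maps of spheres. An upper bound on the Gromov-Hausdorff distance provides an
  ambient space in which every point of \<open>Y\<close> has a nearby point of \<open>X\<close>; choosing one for every \<open>y\<close> gives a map
  \<open>Y \<rightarrow> X\<close> whose distortion is at most twice the bound (\<open>map_distortion_le_hausdorff_dist\<close>). So the
  first claim follows from the second. For the latter, restricting a map \<open>Y \<rightarrow> X\<close> to the embedded hemisphere and composing it with the embedding of
  \<open>X\<close> leaves a map from the closed upper hemisphere of the \<open>(m + 1)\<close>-sphere to the \<open>m\<close>-sphere.

  Such a map extends from one half of the sphere to an odd map of the whole sphere without a change of
  distortion (\<open>hemisphere_map_distortion\<close>), since antipodes turn distances \<open>d\<close> into \<open>\<pi> - d\<close>. Thus
  everything rests on the theorem of Dubins and Schwarz: an odd map from the \<open>(m + 1)\<close>-sphere to the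
  \<open>m\<close>-sphere, continuous or not, has jumps arbitrarily close to \<open>zeta m\<close> or above, where \<open>zeta m\<close> is the
  angle between two vertices of a regular simplex inscribed in the \<open>m\<close>-sphere. If the jumps stayed below a smaller bound, then the values of the map near
  any given point would not have the origin in their convex hull
  (\<open>convex_combination_of_unit_vectors_nonzero\<close>). Averaging them with continuous weights and normalising
  would produce a continuous odd map to the \<open>m\<close>-sphere, which the Borsuk-Ulam theorem excludes.

  The Borsuk-Ulam theorem is proved with singular chains. Hemispheres of all dimensions form an equivariant
  cell decomposition of the sphere. An odd map to the sphere one dimension lower would carry it to chains which, compared
  with the hemispheres of the target, would show the fundamental class of the target to be twice
  another class. By excision and induction on the dimension it is not (\<open>sphere_class_odd\<close>).
\<close>

section \<open>The antipodal map and chains of hemispheres\<close>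

definition antipode :: "(nat \<Rightarrow> real) \<Rightarrow> nat \<Rightarrow> real" where
  "antipode x = (\<lambda>i. - x i)"

lemma antipode_antipode [simp]: "antipode \<circ> antipode = id"
  by (auto simp: antipode_def)

lemma antipode_in_nsphere: "antipode x \<in> topspace (nsphere n) \<longleftrightarrow> x \<in> topspace (nsphere n)"
  by (simp add: antipode_def nsphere)

lemma continuous_map_antipode: "continuous_map (nsphere n) (nsphere n) antipode"
proof -
  have "continuous_map (powertop_real UNIV) euclideanreal (\<lambda>x. - x k)" for k :: nat
    by (metis UNIV_I continuous_map_product_projection continuous_map_minus)
  then show ?thesis
    by (force simp: nsphere continuous_map_in_subtopology antipode_def continuous_map_componentwise_UNIV
        intro: continuous_map_from_subtopology)
qed

text \<open>
  Membership in the reduced homology group, expressed on chains: in degree 0 the sum of the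
  coefficients has to vanish, which says that the chain maps to 0 over a one-point space.
\<close>

definition reduced_cycle :: "nat \<Rightarrow> 'a topology \<Rightarrow> 'a chain \<Rightarrow> bool" where
  "reduced_cycle p X c \<longleftrightarrow> singular_relcycle p X {} c \<and> (p = 0 \<longrightarrow> chain_map 0 (\<lambda>x. ()) c = 0)"

lemma reduced_cycle_in_reduced_homology_group:
  assumes "reduced_cycle p X c"
  shows "homologous_rel_set p X {} c \<in> carrier (reduced_homology_group (int p) X)"
proof -
  have c: "singular_relcycle p X {} c" using assms by (simp add: reduced_cycle_def)
  then have in_hom: "homologous_rel_set p X {} c \<in> carrier (homology_group (int p) X)"
    by (auto simp: carrier_relative_homology_group)
  show ?thesis
  proof (cases "p = 0")
    case True
    have "hom_induced (int 0) X {} (discrete_topology {()}) {} (\<lambda>x. ()) (homologous_rel_set 0 X {} c)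
       = homologous_rel_set 0 (discrete_topology {()}) {} (chain_map 0 (\<lambda>x. ()) c)"
      using c True by (intro hom_induced_chain_map) auto
    also have "\<dots> = singular_relboundary_set 0 (discrete_topology {()}) {}"
      using assms True by (simp add: reduced_cycle_def homologous_rel_set_eq_relboundary)
    finally have "hom_induced (int 0) X {} (discrete_topology {()}) {} (\<lambda>x. ()) (homologous_rel_set 0 X {} c)
       = \<one>\<^bsub>homology_group (int 0) (discrete_topology {()})\<^esub>"
      by (simp only: one_relative_homology_group)
    then show ?thesis
      using in_hom True unfolding carrier_reduced_homology_group by (simp add: kernel_def)
  next
    case False
    then show ?thesis using in_hom by (simp add: un_reduced_homology_group)
  qed
qed

lemma reduced_cycle_imp_boundary:
  assumes "trivial_group (reduced_homology_group (int p) X)" "reduced_cycle p X c"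
  shows "singular_relboundary p X {} c"
proof -
  have "homologous_rel_set p X {} c = \<one>\<^bsub>reduced_homology_group (int p) X\<^esub>"
    using reduced_cycle_in_reduced_homology_group[OF assms(2)] assms(1) by (auto simp: trivial_group_def)
  then show ?thesis
    by (simp add: one_reduced_homology_group homologous_rel_set_eq_relboundary)
qed

text \<open>
  Writing \<open>T\<close> for the antipodal map on chains, this is \<open>D\<^sub>j = 1 + (-1)\<^sup>j T\<close>. As \<open>T\<^sup>2 = 1\<close>, consecutive
  operators satisfy \<open>D\<^sub>j\<^sub>+\<^sub>1 D\<^sub>j = 0\<close>. They are the differentials of the standard resolution of \<open>\<int>\<close> over the group
  ring of the group with two elements, and they turn the hemispheres into an equivariant cell
  decomposition of the sphere.
\<close>

definition antipodal_sum :: "nat \<Rightarrow> nat \<Rightarrow> (nat \<Rightarrow> real) chain \<Rightarrow> (nat \<Rightarrow> real) chain" where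
  "antipodal_sum j p c = c + frag_cmul ((-1) ^ j) (chain_map p antipode c)"

lemma antipodal_sum_diff: "antipodal_sum j p (a - b) = antipodal_sum j p a - antipodal_sum j p b"
  unfolding antipodal_sum_def
  by (intro poly_mapping_eqI) (simp add: chain_map_diff lookup_add lookup_minus algebra_simps)

lemma singular_chain_antipodal_sum: "singular_chain p (nsphere n) c \<Longrightarrow> singular_chain p (nsphere n) (antipodal_sum j p c)"
  unfolding antipodal_sum_def
  by (meson continuous_map_antipode singular_chain_add singular_chain_chain_map singular_chain_cmul)

lemma chain_boundary_antipodal_sum:
  assumes "singular_chain p (nsphere n) c"
  shows "chain_boundary p (antipodal_sum j p c) = antipodal_sum j (p - 1) (chain_boundary p c)"
  unfolding antipodal_sum_def
  by (simp add: chain_boundary_add chain_boundary_cmul chain_boundary_chain_map[OF assms])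

lemma antipodal_sum_twice:
  assumes "singular_chain p (nsphere n) c"
  shows "antipodal_sum (Suc j) p (antipodal_sum j p c) = 0"
proof -
  have "chain_map p antipode (chain_map p antipode c) = c"
    using chain_map_ident[OF assms] by (metis antipode_antipode chain_map_compose o_apply)
  then show ?thesis
    unfolding antipodal_sum_def
    by (intro poly_mapping_eqI) (simp add: chain_map_add lookup_add algebra_simps)
qed

lemma chain_map_antipodal_sum:
  assumes "singular_chain p (nsphere n) c"
    and "\<And>x. x \<in> topspace (nsphere n) \<Longrightarrow> F (antipode x) = antipode (F x)"
  shows "chain_map p F (antipodal_sum j p c) = antipodal_sum j p (chain_map p F c)"
proof -
  have "chain_map p F (chain_map p antipode c) = chain_map p (F \<circ> antipode) c"
    by (simp add: chain_map_compose)
  also have "\<dots> = chain_map p (antipode \<circ> F) c"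
    using assms by (intro chain_map_eq) auto
  also have "\<dots> = chain_map p antipode (chain_map p F c)"
    by (simp add: chain_map_compose)
  finally show ?thesis by (simp add: antipodal_sum_def chain_map_add)
qed

definition upper_hemisphere_space :: "nat \<Rightarrow> (nat \<Rightarrow> real) topology" where
  "upper_hemisphere_space n = subtopology (nsphere n) {x. x n \<ge> 0}"

lemma singular_chain_upper: "singular_chain p (upper_hemisphere_space n) c \<Longrightarrow> singular_chain p (nsphere n) c"
  by (simp add: upper_hemisphere_space_def singular_chain_subtopology)

text \<open>
  The chain \<open>u k\<close> represents the upper hemisphere of the \<open>k\<close>-sphere. Its boundary is the \<open>(k - 1)\<close>-sphere,
  put together from \<open>u (k - 1)\<close> and its antipode with the appropriate sign.
\<close>

definition hemisphere_chains :: "(nat \<Rightarrow> (nat \<Rightarrow> real) chain) \<Rightarrow> bool" where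
  "hemisphere_chains u \<longleftrightarrow>
     (\<exists>v. u 0 = frag_of v) \<and>
     (\<forall>k. singular_chain k (upper_hemisphere_space k) (u k)) \<and>
     (\<forall>k. chain_boundary (Suc k) (u (Suc k)) = antipodal_sum (Suc k) k (u k))"

text \<open>
  The sum \<open>D\<^sub>k\<^sub>+\<^sub>1 u\<^sub>k\<close> is a reduced cycle in the equator of the next hemisphere, and that hemisphere is
  contractible, so the cycle bounds there.
\<close>

lemma hemisphere_chains_exist: "\<exists>u. hemisphere_chains u"
proof -
  define north :: "nat \<Rightarrow> real" where "north = (\<lambda>i. if i = 0 then 1 else 0)"
  define v :: "(nat \<Rightarrow> real) \<Rightarrow> nat \<Rightarrow> real" where "v = (\<lambda>x\<in>standard_simplex 0. north)"
  define P where "P k c \<longleftrightarrow> singular_chain k (upper_hemisphere_space k) c \<and>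
     reduced_cycle k (nsphere k) (antipodal_sum (Suc k) k c) \<and> (k = 0 \<longrightarrow> c = frag_of v)" for k c
  have "\<exists>u. \<forall>k. P k (u k) \<and> chain_boundary (Suc k) (u (Suc k)) = antipodal_sum (Suc k) k (u k)"
  proof (rule dependent_nat_choice)
    have north: "north \<in> topspace (upper_hemisphere_space 0)"
      by (auto simp: upper_hemisphere_space_def north_def in_topspace_nsphere)
    have "singular_simplex 0 (upper_hemisphere_space 0) v"
      using north by (auto simp: singular_simplex_def v_def)
    then have v: "singular_chain 0 (upper_hemisphere_space 0) (frag_of v)"
      by (simp add: singular_chain_of)
    have "simplex_map 0 (\<lambda>x. ()) f = (\<lambda>x\<in>standard_simplex 0. ())" for f :: "(nat \<Rightarrow> real) \<Rightarrow> nat \<Rightarrow> real"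
      by (simp add: simplex_map_def o_def)
    then have "chain_map 0 (\<lambda>x. ()) (antipodal_sum (Suc 0) 0 (frag_of v)) = 0"
      by (simp add: antipodal_sum_def chain_map_diff)
    then have "P 0 (frag_of v)"
      using v singular_chain_antipodal_sum[OF singular_chain_upper[OF v]]
      by (simp add: P_def reduced_cycle_def singular_cycle chain_boundary_def)
    then show "\<exists>c. P 0 c" ..
  next
    fix c k
    assume c: "P k c"
    define s where "s = antipodal_sum (Suc k) k c"
    have nsphere_sub: "nsphere k = subtopology (upper_hemisphere_space (Suc k)) {x. x (Suc k) = 0}"
      unfolding upper_hemisphere_space_def subtopology_subtopology
      by (subst subtopology_nsphere_equator[symmetric]) (rule arg_cong2[where f=subtopology], auto)
    have "singular_chain k (nsphere k) s"
      using c by (simp add: P_def reduced_cycle_def singular_cycle s_def)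
    then have sk: "singular_chain k (upper_hemisphere_space (Suc k)) s"
      by (simp add: nsphere_sub singular_chain_subtopology)
    then have "reduced_cycle k (upper_hemisphere_space (Suc k)) s"
      using c unfolding P_def reduced_cycle_def singular_cycle s_def by blast
    moreover have "trivial_group (reduced_homology_group (int k) (upper_hemisphere_space (Suc k)))"
      unfolding upper_hemisphere_space_def
      by (intro trivial_reduced_homology_group_contractible_space contractible_space_upper_hemisphere) simp
    ultimately obtain d where d: "singular_chain (Suc k) (upper_hemisphere_space (Suc k)) d" "chain_boundary (Suc k) d = s"
      using reduced_cycle_imp_boundary singular_boundary by metis
    have d': "singular_chain (Suc k) (nsphere (Suc k)) d"
      using d singular_chain_upper by blast
    have "chain_boundary (Suc k) (antipodal_sum (Suc (Suc k)) (Suc k) d) = 0"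
      using chain_boundary_antipodal_sum[OF d'] d(2) antipodal_sum_twice[of k k c "Suc k"] c
        singular_chain_upper by (simp add: s_def P_def)
    then have "P (Suc k) d"
      using d d' singular_chain_antipodal_sum by (simp add: P_def reduced_cycle_def singular_cycle)
    with d show "\<exists>d. P (Suc k) d \<and> chain_boundary (Suc k) d = antipodal_sum (Suc k) k c"
      by (auto simp: s_def)
  qed
  then obtain u where "\<And>k. P k (u k)" "\<And>k. chain_boundary (Suc k) (u (Suc k)) = antipodal_sum (Suc k) k (u k)"
    by blast
  then show ?thesis
    unfolding hemisphere_chains_def P_def by blast
qed

section \<open>The fundamental class of a sphere is not even\<close>

text \<open>
  The next two lemmas are surjectivity and injectivity of the excision isomorphism from the upper
  hemisphere modulo the equator to the sphere modulo the lower hemisphere, stated for chains.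
\<close>

lemma excise_lower_hemisphere:
  assumes z: "singular_relcycle k (nsphere n) {x. x n \<le> 0} z"
  obtains z' where "singular_relcycle k (upper_hemisphere_space n) {x. x n = 0} z'"
    "singular_relboundary k (nsphere n) {x. x n \<le> 0} (z - z')"
proof -
  let ?h = "hom_induced (int k) (upper_hemisphere_space n) {x. x n = 0} (nsphere n) {x. x n \<le> 0} id"
  have "?h ` carrier (relative_homology_group (int k) (upper_hemisphere_space n) {x. x n = 0})
     = carrier (relative_homology_group (int k) (nsphere n) {x. x n \<le> 0})"
    using iso_relative_homology_group_upper_hemisphere[of "int k" n n] by (simp add: iso_iff upper_hemisphere_space_def)
  moreover have "homologous_rel_set k (nsphere n) {x. x n \<le> 0} z
     \<in> carrier (relative_homology_group (int k) (nsphere n) {x. x n \<le> 0})"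
    using z by (auto simp: carrier_relative_homology_group)
  ultimately obtain w where w: "w \<in> carrier (relative_homology_group (int k) (upper_hemisphere_space n) {x. x n = 0})"
    and hw: "homologous_rel_set k (nsphere n) {x. x n \<le> 0} z = ?h w"
    by (metis (no_types, lifting) imageE)
  from w obtain z' where z': "singular_relcycle k (upper_hemisphere_space n) {x. x n = 0} z'"
    and wz': "w = homologous_rel_set k (upper_hemisphere_space n) {x. x n = 0} z'"
    unfolding carrier_relative_homology_group by blast
  from hw have eq: "homologous_rel_set k (nsphere n) {x. x n \<le> 0} z = ?h (homologous_rel_set k (upper_hemisphere_space n) {x. x n = 0} z')"
    unfolding wz' .
  have "?h (homologous_rel_set k (upper_hemisphere_space n) {x. x n = 0} z')
     = homologous_rel_set k (nsphere n) {x. x n \<le> 0} (chain_map k id z')"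
    using z' by (intro hom_induced_chain_map) (auto simp: upper_hemisphere_space_def)
  also have "chain_map k id z' = z'"
    using z' by (intro chain_map_ident) (auto simp: singular_relcycle)
  finally have "homologous_rel k (nsphere n) {x. x n \<le> 0} z z'"
    using eq homologous_rel_set_eq by metis
  then show thesis
    using that z' by (simp add: homologous_rel_def)
qed

lemma relboundary_excise_lower_hemisphere:
  assumes c: "singular_relcycle k (upper_hemisphere_space n) {x. x n = 0} c"
    and b: "singular_relboundary k (nsphere n) {x. x n \<le> 0} c"
  shows "singular_relboundary k (upper_hemisphere_space n) {x. x n = 0} c"
proof -
  let ?U = "{x::nat\<Rightarrow>real. x n = 0}" and ?L = "{x::nat\<Rightarrow>real. x n \<le> 0}"
  let ?h = "hom_induced (int k) (upper_hemisphere_space n) ?U (nsphere n) ?L id"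
  have h: "?h (homologous_rel_set k (upper_hemisphere_space n) ?U a) = homologous_rel_set k (nsphere n) ?L a"
    if a: "singular_relcycle k (upper_hemisphere_space n) ?U a" for a
  proof -
    have "?h (homologous_rel_set k (upper_hemisphere_space n) ?U a) = homologous_rel_set k (nsphere n) ?L (chain_map k id a)"
      using a by (intro hom_induced_chain_map) (auto simp: upper_hemisphere_space_def)
    also have "chain_map k id a = a"
      using a by (intro chain_map_ident) (auto simp: singular_relcycle)
    finally show ?thesis .
  qed
  have inj: "inj_on ?h (carrier (relative_homology_group (int k) (upper_hemisphere_space n) ?U))"
    using iso_relative_homology_group_upper_hemisphere[of "int k" n n] by (simp add: iso_iff upper_hemisphere_space_def)
  have eq: "?h (homologous_rel_set k (upper_hemisphere_space n) ?U c) = ?h (homologous_rel_set k (upper_hemisphere_space n) ?U 0)"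
    unfolding h[OF c] h[OF singular_relcycle_0] homologous_rel_set_eq
    using b by (simp add: homologous_rel_def)
  have mem: "homologous_rel_set k (upper_hemisphere_space n) ?U a \<in> carrier (relative_homology_group (int k) (upper_hemisphere_space n) ?U)"
    if "singular_relcycle k (upper_hemisphere_space n) ?U a" for a
    using that unfolding carrier_relative_homology_group by blast
  have "homologous_rel_set k (upper_hemisphere_space n) ?U c = homologous_rel_set k (upper_hemisphere_space n) ?U 0"
    by (rule inj_onD[OF inj eq mem[OF c] mem[OF singular_relcycle_0]])
  then have "homologous_rel k (upper_hemisphere_space n) ?U c 0"
    unfolding homologous_rel_set_eq .
  then show ?thesis
    by (simp add: homologous_rel_def)
qed

text \<open>
  The sum of the coefficients at the point 1 of the 0-sphere. It takes values in the free group on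
  one generator because \<open>frag_extend\<close> extends functions linearly into free Abelian groups.
\<close>

definition positive_coefficient_sum :: "(nat \<Rightarrow> real) chain \<Rightarrow> unit \<Rightarrow>\<^sub>0 int" where
  "positive_coefficient_sum =
     frag_extend (\<lambda>f. if f (\<lambda>j. if j = 0 then 1 else 0) 0 > 0 then frag_of () else 0)"

text \<open>
  A path in the 0-sphere has both ends at the same point, by the intermediate value theorem.
\<close>

lemma positive_coefficient_sum_boundary:
  assumes d: "singular_chain 1 (nsphere 0) d"
  shows "positive_coefficient_sum (chain_boundary 1 d) = 0"
proof -
  define e :: "nat \<Rightarrow> real" where "e = (\<lambda>j. if j = 0 then 1 else 0)"
  have simplex: "positive_coefficient_sum (chain_boundary 1 (frag_of f)) = 0" if f: "singular_simplex 1 (nsphere 0) f" for f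
  proof -
    let ?S = "subtopology (powertop_real UNIV) (standard_simplex 1)"
    have cf: "continuous_map ?S (nsphere 0) f"
      using f by (simp add: singular_simplex_def)
    have "continuous_map ?S euclideanreal (\<lambda>x. f x 0)"
      using continuous_map_compose[OF cf continuous_map_nsphere_projection[of 0 0]] by (simp add: o_def)
    moreover have "connectedin ?S (standard_simplex 1)"
      by (simp add: connectedin_subtopology connectedin_standard_simplex)
    ultimately have "connectedin euclideanreal ((\<lambda>x. f x 0) ` standard_simplex 1)"
      by (rule connectedin_continuous_map_image)
    then have conn: "connected ((\<lambda>x. f x 0) ` standard_simplex 1)"
      by simp
    have nz: "f x 0 \<noteq> 0" if "x \<in> standard_simplex 1" for x
    proof -
      have "f x \<in> topspace (nsphere 0)"
        using cf that by (auto simp: continuous_map_def)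
      then show ?thesis by (auto simp: nsphere)
    qed
    have no_sign_change: False
      if "x \<in> standard_simplex 1" "y \<in> standard_simplex 1" "f x 0 > 0" "\<not> f y 0 > 0" for x y
    proof -
      have "0 \<in> (\<lambda>x. f x 0) ` standard_simplex 1"
        using connectedD_interval[OF conn, of "f y 0" "f x 0" 0] that by auto
      then show False using nz by force
    qed
    have e: "e \<in> standard_simplex 0" by (simp add: e_def)
    then have faces: "simplical_face 0 e \<in> standard_simplex 1" "simplical_face 1 e \<in> standard_simplex 1"
      by (auto intro!: simplical_face_in_standard_simplex)
    have "(f (simplical_face 0 e) 0 > 0) = (f (simplical_face 1 e) 0 > 0)"
      using no_sign_change faces by blast
    then have "(singular_face 1 0 f e 0 > 0) = (singular_face 1 1 f e 0 > 0)"
      using e by (simp add: singular_face_def)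
    then show ?thesis
      by (simp add: positive_coefficient_sum_def e_def chain_boundary_of frag_extend_diff)
  qed
  show ?thesis
    using d unfolding singular_chain_def
  proof (induction rule: frag_induction)
    case (diff a b)
    then show ?case
      by (simp add: positive_coefficient_sum_def chain_boundary_diff frag_extend_diff)
  qed (use simplex in \<open>auto simp: positive_coefficient_sum_def\<close>)
qed

lemma hemisphere_chains_relcycle:
  assumes u: "hemisphere_chains u"
  shows "singular_chain k (upper_hemisphere_space k) (u k)"
   and "singular_relcycle k (nsphere k) {} (antipodal_sum (Suc k) k (u k))"
proof -
  show c: "singular_chain k (upper_hemisphere_space k) (u k)" for k using u by (simp add: hemisphere_chains_def)
  have c': "singular_chain k (nsphere k) (u k)" for k
    using c singular_chain_upper by blast
  have "chain_boundary k (antipodal_sum (Suc k) k (u k)) = 0"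
  proof (cases k)
    case 0
    then show ?thesis by (simp add: chain_boundary_def)
  next
    case (Suc j)
    have "chain_boundary k (antipodal_sum (Suc k) k (u k)) = antipodal_sum (Suc k) j (antipodal_sum k j (u j))"
      using u chain_boundary_antipodal_sum[OF c'[of k], where j = "Suc k"] by (simp add: hemisphere_chains_def Suc)
    then show ?thesis by (simp add: antipodal_sum_twice[OF c'])
  qed
  then show "singular_relcycle k (nsphere k) {} (antipodal_sum (Suc k) k (u k))"
    by (simp add: singular_cycle singular_chain_antipodal_sum[OF c'])
qed

lemma boundary_imp_relboundary:
  assumes "singular_relboundary p X {} c"
  shows "singular_relboundary p X S c"
proof -
  obtain d where "singular_chain (Suc p) X d" "chain_boundary (Suc p) d = c + 0"
    using assms by (auto simp: singular_boundary)
  then show ?thesis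
    unfolding singular_relboundary_alt using singular_chain_0 by blast
qed

text \<open>
  The class of \<open>D\<^sub>k\<^sub>+\<^sub>1 u\<^sub>k\<close> generates the homology of the \<open>k\<close>-sphere, and so it is not twice
  another class. The latter property is the one that passes easily from one dimension to the next: if \<open>D\<^sub>k\<^sub>+\<^sub>1 u\<^sub>k + 2z\<close>
  bounds, then modulo the lower hemisphere so does \<open>u\<^sub>k + 2z\<close>, because \<open>T u\<^sub>k\<close> lies in that hemisphere.
  Excision moves this relation into the upper hemisphere modulo the equator, and the boundary operator
  then yields a relation of the same kind in the equator.
\<close>

lemma sphere_class_odd:
  assumes u: "hemisphere_chains u" and z: "singular_relcycle k (nsphere k) {} z"
  shows "\<not> singular_relboundary k (nsphere k) {} (antipodal_sum (Suc k) k (u k) + frag_cmul 2 z)"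
  using z
proof (induction k arbitrary: z)
  case 0
  show ?case
  proof
    assume "singular_relboundary 0 (nsphere 0) {} (antipodal_sum (Suc 0) 0 (u 0) + frag_cmul 2 z)"
    then obtain d where d: "singular_chain 1 (nsphere 0) d"
      "chain_boundary 1 d = antipodal_sum (Suc 0) 0 (u 0) + frag_cmul 2 z"
      by (auto simp: singular_boundary)
    obtain v where v: "u 0 = frag_of v" using u by (auto simp: hemisphere_chains_def)
    define e :: "nat \<Rightarrow> real" where "e = (\<lambda>j. if j = 0 then 1 else 0)"
    let ?\<phi> = positive_coefficient_sum
    have "?\<phi> (chain_boundary 1 d) = 0"
      by (rule positive_coefficient_sum_boundary[OF d(1)])
    then have "?\<phi> (antipodal_sum (Suc 0) 0 (u 0)) + frag_cmul 2 (?\<phi> z) = 0"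
      unfolding d(2) by (simp add: positive_coefficient_sum_def frag_extend_add frag_extend_cmul)
    moreover have "?\<phi> (antipodal_sum (Suc 0) 0 (u 0)) = frag_of ()"
    proof -
      have "singular_simplex 0 (upper_hemisphere_space 0) v"
        using hemisphere_chains_relcycle(1)[OF u, of 0] by (simp add: v singular_chain_of)
      then have "v \<in> standard_simplex 0 \<rightarrow> topspace (upper_hemisphere_space 0)"
        by (auto simp: singular_simplex_def continuous_map_def)
      moreover have e: "e \<in> standard_simplex 0" by (simp add: e_def)
      ultimately have "v e \<in> topspace (upper_hemisphere_space 0)" by blast
      then have "v e 0 \<ge> 0" "(v e 0)\<^sup>2 = 1"
        by (simp_all add: upper_hemisphere_space_def nsphere)
      then have "v e 0 > 0"
        by (cases "v e 0 = 0") auto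
      then show ?thesis
        using e by (simp add: v antipodal_sum_def positive_coefficient_sum_def e_def frag_extend_diff
              simplex_map_def antipode_def)
    qed
    ultimately have "poly_mapping.lookup (frag_of () + frag_cmul 2 (?\<phi> z)) () = 0"
      by simp
    \<comment> \<open>The north pole has coefficient 1 in \<open>D\<^sub>1 u\<^sub>0\<close>, so the relation reads \<open>1 + 2a = 0\<close>.\<close>
    then have "1 + 2 * poly_mapping.lookup (?\<phi> z) () = 0"
      by (simp add: lookup_add)
    then show False by presburger
  qed
next
  case (Suc k)
  let ?n = "Suc k"
  let ?L = "{x::nat\<Rightarrow>real. x ?n \<le> 0}" and ?E = "{x::nat\<Rightarrow>real. x ?n = 0}"
  have sub_E: "subtopology (upper_hemisphere_space ?n) ?E = nsphere k"
    unfolding upper_hemisphere_space_def subtopology_subtopology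
    by (subst subtopology_nsphere_equator[symmetric]) (rule arg_cong2[where f=subtopology], auto)
  show ?case
  proof
    assume "singular_relboundary ?n (nsphere ?n) {} (antipodal_sum (Suc ?n) ?n (u ?n) + frag_cmul 2 z)"
    then have b: "singular_relboundary ?n (nsphere ?n) ?L (antipodal_sum (Suc ?n) ?n (u ?n) + frag_cmul 2 z)"
      by (rule boundary_imp_relboundary)
    have un: "singular_chain ?n (upper_hemisphere_space ?n) (u ?n)"
      by (rule hemisphere_chains_relcycle(1)[OF u])
    have "continuous_map (upper_hemisphere_space ?n) (subtopology (nsphere ?n) ?L) antipode"
      using continuous_map_antipode[of ?n]
      by (auto simp: upper_hemisphere_space_def continuous_map_in_subtopology continuous_map_from_subtopology antipode_def)
    then have "singular_chain ?n (subtopology (nsphere ?n) ?L) (chain_map ?n antipode (u ?n))"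
      using singular_chain_chain_map[OF un] by blast
    then have "singular_relboundary ?n (nsphere ?n) ?L (frag_cmul ((-1)^Suc ?n) (chain_map ?n antipode (u ?n)))"
      by (intro singular_chain_imp_relboundary singular_chain_cmul)
    from singular_relboundary_diff[OF b this]
    have b1: "singular_relboundary ?n (nsphere ?n) ?L (u ?n + frag_cmul 2 z)"
      by (simp add: antipodal_sum_def algebra_simps)
    have "singular_relcycle ?n (nsphere ?n) ?L z"
      using Suc.prems unfolding singular_cycle by (simp add: singular_relcycle)
    then obtain z' where z': "singular_relcycle ?n (upper_hemisphere_space ?n) ?E z'"
      and zz': "singular_relboundary ?n (nsphere ?n) ?L (z - z')"
      by (rule excise_lower_hemisphere)
    have "singular_relboundary ?n (nsphere ?n) ?L (u ?n + frag_cmul 2 z')"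
    proof -
      have "u ?n + frag_cmul 2 z' = (u ?n + frag_cmul 2 z) - frag_cmul 2 (z - z')"
        by (intro poly_mapping_eqI) (simp add: lookup_add lookup_minus algebra_simps)
      then show ?thesis
        using singular_relboundary_diff[OF b1 singular_relboundary_cmul[OF zz', of 2]] by (simp only:)
    qed
    moreover
    have bu: "chain_boundary ?n (u ?n) = antipodal_sum (Suc k) k (u k)"
      using u by (simp add: hemisphere_chains_def)
    then have "singular_relcycle ?n (upper_hemisphere_space ?n) ?E (u ?n)"
      using un hemisphere_chains_relcycle(2)[OF u, of k] unfolding singular_cycle
      by (simp add: singular_relcycle sub_E)
    then have "singular_relcycle ?n (upper_hemisphere_space ?n) ?E (u ?n + frag_cmul 2 z')"
      using z' by (intro singular_relcycle_add singular_relcycle_cmul)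
    ultimately have "singular_relboundary ?n (upper_hemisphere_space ?n) ?E (u ?n + frag_cmul 2 z')"
      by (rule relboundary_excise_lower_hemisphere[rotated])
    then obtain d c where d: "singular_chain (Suc ?n) (upper_hemisphere_space ?n) d" and c: "singular_chain ?n (nsphere k) c"
      and eq: "chain_boundary (Suc ?n) d = (u ?n + frag_cmul 2 z') + c"
      unfolding singular_relboundary_alt sub_E by blast
    have "chain_boundary ?n (u ?n + frag_cmul 2 z') + chain_boundary ?n c = 0"
      using chain_boundary_boundary_alt[OF d] by (simp add: eq chain_boundary_add)
    then have "chain_boundary ?n (- c) = antipodal_sum (Suc k) k (u k) + frag_cmul 2 (chain_boundary ?n z')"
      by (simp add: chain_boundary_add chain_boundary_cmul chain_boundary_minus bu add_eq_0_iff2)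
    moreover have "singular_chain ?n (nsphere k) (- c)"
      using c by (simp add: singular_chain_minus)
    ultimately have "singular_relboundary k (nsphere k) {} (antipodal_sum (Suc k) k (u k) + frag_cmul 2 (chain_boundary ?n z'))"
      unfolding singular_boundary by blast
    moreover have "singular_relcycle k (nsphere k) {} (chain_boundary ?n z')"
      using z' chain_boundary_boundary_alt[of k "upper_hemisphere_space ?n" z']
      unfolding singular_cycle by (simp add: singular_relcycle sub_E)
    ultimately show False
      using Suc.IH by blast
  qed
qed

section \<open>The Borsuk-Ulam theorem\<close>

text \<open>
  The antipodal map is a homeomorphism, hence of degree 1 or -1.
\<close>

lemma antipode_homologous:
  assumes "reduced_cycle n (nsphere n) z"
  shows "singular_relboundary n (nsphere n) {} (chain_map n antipode z - z) \<or>
    singular_relboundary n (nsphere n) {} (chain_map n antipode z + z)"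
proof -
  let ?G = "reduced_homology_group (int n) (nsphere n)"
  interpret group ?G by simp
  have z: "singular_relcycle n (nsphere n) {} z"
    using assms by (simp add: reduced_cycle_def)
  define w where "w = homologous_rel_set n (nsphere n) {} z"
  have w: "w \<in> carrier ?G"
    unfolding w_def by (rule reduced_cycle_in_reduced_homology_group[OF assms])
  have "homeomorphic_map (nsphere n) (nsphere n) antipode"
    using continuous_map_antipode[of n]
    by (intro homeomorphic_maps_imp_map[of _ _ _ antipode])
      (auto simp: homeomorphic_maps_def antipode_def)
  then have "Brouwer_degree2 n antipode = 1 \<or> Brouwer_degree2 n antipode = - 1"
    using Brouwer_degree2_homeomorphic_map by fastforce
  moreover have deg: "hom_induced (int n) (nsphere n) {} (nsphere n) {} antipode w = w [^]\<^bsub>?G\<^esub> Brouwer_degree2 n antipode"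
    by (rule Brouwer_degree2[OF w])
  moreover have img: "hom_induced (int n) (nsphere n) {} (nsphere n) {} antipode w
      = homologous_rel_set n (nsphere n) {} (chain_map n antipode z)"
    unfolding w_def using continuous_map_antipode z by (intro hom_induced_chain_map) auto
  moreover have inv: "w [^]\<^bsub>?G\<^esub> (-1::int) = homologous_rel_set n (nsphere n) {} (- z)"
  proof -
    let ?H = "homology_group (int n) (nsphere n)"
    have wH: "w \<in> carrier ?H"
      using w carrier_reduced_homology_group_subset by blast
    have "w [^]\<^bsub>?G\<^esub> (-1::int) = w [^]\<^bsub>?H\<^esub> (-1::int)"
      using w unfolding reduced_homology_group_def
      by (intro group.int_pow_subgroup_generated) auto
    also have "\<dots> = inv\<^bsub>?H\<^esub> w"
      using wH by (simp add: group.int_pow_neg group.int_pow_1)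
    also have "\<dots> = uminus ` w"
      using wH by (rule inv_relative_homology_group)
    also have "\<dots> = homologous_rel_set n (nsphere n) {} (- z)"
    proof -
      have eq: "homologous_rel n (nsphere n) {} (- z) (- y) = homologous_rel n (nsphere n) {} z y" for y
        using singular_relboundary_minus[of n "nsphere n" "{}" "z - y"]
        by (simp add: homologous_rel_def)
      show ?thesis
      proof (intro equalityI subsetI)
        fix y assume "y \<in> uminus ` w"
        then show "y \<in> homologous_rel_set n (nsphere n) {} (- z)"
          using eq by (auto simp: w_def)
      next
        fix y assume "y \<in> homologous_rel_set n (nsphere n) {} (- z)"
        then have "- y \<in> w" using eq[of "- y"] by (simp add: w_def)
        then show "y \<in> uminus ` w" by force
      qed
    qed
    finally show ?thesis .
  qed
  ultimately have "homologous_rel_set n (nsphere n) {} (chain_map n antipode z) = homologous_rel_set n (nsphere n) {} z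
    \<or> homologous_rel_set n (nsphere n) {} (chain_map n antipode z) = homologous_rel_set n (nsphere n) {} (- z)"
    using w w_def by force
  then have "singular_relboundary n (nsphere n) {} (chain_map n antipode z - z) \<or>
    singular_relboundary n (nsphere n) {} (chain_map n antipode z - - z)"
    unfolding homologous_rel_set_eq unfolding homologous_rel_def .
  then show ?thesis by simp
qed

text \<open>
  Let \<open>e\<^sub>k\<close> be the image of the hemisphere chain \<open>u\<^sub>k\<close> under \<open>F\<close>. As \<open>F\<close> is odd, the \<open>e\<^sub>k\<close> satisfy the same
  boundary relations as the \<open>u\<^sub>k\<close>. The \<open>n\<close>-sphere has no reduced homology below dimension \<open>n\<close>, and so
  there are chains \<open>w\<^sub>k\<close> making each \<open>z\<^sub>k = e\<^sub>k - u\<^sub>k - D\<^sub>k w\<^sub>k\<close> a reduced cycle, the boundary of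
  \<open>w\<^sub>k\<^sub>+\<^sub>1\<close> if \<open>k < n\<close>. Applying \<open>D\<^sub>n\<^sub>+\<^sub>1\<close> to \<open>z\<^sub>n\<close> kills the term with \<open>w\<^sub>n\<close>. Moreover \<open>D\<^sub>n\<^sub>+\<^sub>1 e\<^sub>n\<close> is a boundary, because
  \<open>F\<close> is also defined on the hemisphere of dimension \<open>n + 1\<close>. Hence \<open>D\<^sub>n\<^sub>+\<^sub>1 u\<^sub>n + D\<^sub>n\<^sub>+\<^sub>1 z\<^sub>n\<close> bounds. But \<open>T z\<^sub>n\<close> is
  homologous to \<open>z\<^sub>n\<close> or \<open>-z\<^sub>n\<close>, so \<open>D\<^sub>n\<^sub>+\<^sub>1 z\<^sub>n\<close> is twice a cycle up to a boundary, against \<open>sphere_class_odd\<close>.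
\<close>

theorem Borsuk_Ulam:
  assumes F: "continuous_map (nsphere (Suc n)) (nsphere n) F"
    and odd: "\<And>x. x \<in> topspace (nsphere (Suc n)) \<Longrightarrow> F (antipode x) = antipode (F x)"
  shows False
proof -
  obtain u where u: "hemisphere_chains u" using hemisphere_chains_exist ..
  have sub: "singular_chain p (nsphere j) c" if "k \<le> j" "singular_chain p (nsphere k) c" for k j p c
    using that
  proof (induction j rule: dec_induct)
    case (step j)
    then have "singular_chain p (subtopology (nsphere (Suc j)) {x. x (Suc j) = 0}) c"
      by (simp add: subtopology_nsphere_equator)
    then show ?case by (simp add: singular_chain_subtopology)
  qed auto
  have uk: "singular_chain k (nsphere j) (u k)" if "k \<le> j" for k j
    using hemisphere_chains_relcycle(1)[OF u, of k] singular_chain_upper sub that by blast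
  define e where "e k = chain_map k F (u k)" for k
  have e: "singular_chain k (nsphere n) (e k)" if "k \<le> Suc n" for k
    unfolding e_def using uk[OF that] F singular_chain_chain_map by blast
  have be: "chain_boundary (Suc k) (e (Suc k)) = antipodal_sum (Suc k) k (e k)" if "k \<le> n" for k
  proof -
    have "chain_boundary (Suc k) (e (Suc k)) = chain_map k F (antipodal_sum (Suc k) k (u k))"
      using chain_boundary_chain_map[OF uk[of "Suc k" "Suc n"], of F] that u
      by (simp add: e_def hemisphere_chains_def)
    also have "\<dots> = antipodal_sum (Suc k) k (e k)"
      unfolding e_def using uk[of k "Suc n"] that odd by (intro chain_map_antipodal_sum) auto
    finally show ?thesis .
  qed
  have bu: "chain_boundary (Suc k) (u (Suc k)) = antipodal_sum (Suc k) k (u k)" for k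
    using u by (simp add: hemisphere_chains_def)
  have "\<exists>w. singular_chain k (nsphere n) w \<and>
     reduced_cycle k (nsphere n) (e k - u k - antipodal_sum k k w)" if "k \<le> n" for k
    using that
  proof (induction k)
    case 0
    obtain v where v: "u 0 = frag_of v" using u by (auto simp: hemisphere_chains_def)
    have "simplex_map 0 (\<lambda>x. ()) f = (\<lambda>x\<in>standard_simplex 0. ())" for f :: "(nat \<Rightarrow> real) \<Rightarrow> nat \<Rightarrow> real"
      by (simp add: simplex_map_def o_def)
    \<comment> \<open>Both chains are single points, so the coefficients of the difference add up to 0.\<close>
    then have "chain_map 0 (\<lambda>x. ()) (e 0 - u 0) = 0"
      by (simp add: e_def v chain_map_diff)
    then show ?case
      using e[of 0] uk[of 0 n]
      by (intro exI[of _ 0]) (simp add: reduced_cycle_def singular_cycle chain_boundary_def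
          antipodal_sum_def singular_chain_diff)
  next
    case (Suc k)
    then obtain w where w: "singular_chain k (nsphere n) w"
      and red: "reduced_cycle k (nsphere n) (e k - u k - antipodal_sum k k w)" by auto
    obtain w' where w': "singular_chain (Suc k) (nsphere n) w'"
      and bw': "chain_boundary (Suc k) w' = e k - u k - antipodal_sum k k w"
      using reduced_cycle_imp_boundary[OF _ red] reduced_homology_group_nsphere(2)[of "int k" n] Suc.prems
      by (auto simp: singular_boundary)
    have "chain_boundary (Suc k) (e (Suc k) - u (Suc k) - antipodal_sum (Suc k) (Suc k) w') = 0"
      using chain_boundary_antipodal_sum[OF w', of "Suc k"] be[of k] bu[of k] Suc.prems
      by (simp add: chain_boundary_diff bw' antipodal_sum_diff antipodal_sum_twice[OF w])
    then show ?case
      using w' e[of "Suc k"] uk[of "Suc k" n] Suc.prems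
      by (intro exI[of _ w']) (simp add: reduced_cycle_def singular_cycle singular_chain_diff
          singular_chain_antipodal_sum)
  qed
  from this[of n] obtain w where w: "singular_chain n (nsphere n) w"
    and red: "reduced_cycle n (nsphere n) (e n - u n - antipodal_sum n n w)" by auto
  define z where "z = e n - u n - antipodal_sum n n w"
  have z: "singular_relcycle n (nsphere n) {} z"
    using red by (simp add: reduced_cycle_def z_def)
  have "antipodal_sum (Suc n) n z = chain_boundary (Suc n) (e (Suc n)) - antipodal_sum (Suc n) n (u n)"
    by (simp add: z_def antipodal_sum_diff antipodal_sum_twice[OF w] be)
  then have b: "singular_relboundary n (nsphere n) {} (antipodal_sum (Suc n) n z + antipodal_sum (Suc n) n (u n))"
    unfolding singular_boundary using e[of "Suc n"] by auto
  \<comment> \<open>The witness is \<open>z\<close> or 0, according to whether the sign of \<open>T\<close> in \<open>D\<^sub>n\<^sub>+\<^sub>1\<close> agrees with its degree.\<close>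
  have "\<exists>y. singular_relcycle n (nsphere n) {} y \<and>
     singular_relboundary n (nsphere n) {} (frag_cmul 2 y - antipodal_sum (Suc n) n z)"
  proof -
    define T where "T = chain_map n antipode z"
    have T: "singular_relboundary n (nsphere n) {} (T - z) \<or> singular_relboundary n (nsphere n) {} (T + z)"
      unfolding T_def using antipode_homologous red by (simp add: z_def)
    consider "antipodal_sum (Suc n) n z = z + T" | "antipodal_sum (Suc n) n z = z - T"
      by (cases "even n") (auto simp: antipodal_sum_def T_def)
    then show ?thesis
    proof cases
      case 1
      show ?thesis
      proof (rule disjE[OF T])
        assume T: "singular_relboundary n (nsphere n) {} (T - z)"
        have "frag_cmul 2 z - (z + T) = - (T - z)"
          by (intro poly_mapping_eqI) (simp add: lookup_add lookup_minus)
        then show ?thesis using z 1 T singular_relboundary_minus by metis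
      next
        assume "singular_relboundary n (nsphere n) {} (T + z)"
        moreover have "frag_cmul 2 0 - (z + T) = - (T + z)" by simp
        ultimately have "singular_relboundary n (nsphere n) {} (frag_cmul 2 0 - (z + T))"
          by (simp only: singular_relboundary_minus)
        then show ?thesis using 1 singular_relcycle_0 by metis
      qed
    next
      case 2
      show ?thesis
      proof (rule disjE[OF T])
        assume T: "singular_relboundary n (nsphere n) {} (T - z)"
        then have "singular_relboundary n (nsphere n) {} (frag_cmul 2 0 - (z - T))"
          by simp
        then show ?thesis using 2 singular_relcycle_0 by metis
      next
        assume T: "singular_relboundary n (nsphere n) {} (T + z)"
        have "frag_cmul 2 z - (z - T) = T + z"
          by (intro poly_mapping_eqI) (simp add: lookup_add lookup_minus)
        then show ?thesis using z 2 T by metis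
      qed
    qed
  qed
  then obtain y where y: "singular_relcycle n (nsphere n) {} y"
    and yb: "singular_relboundary n (nsphere n) {} (frag_cmul 2 y - antipodal_sum (Suc n) n z)" by blast
  have "singular_relboundary n (nsphere n) {} (antipodal_sum (Suc n) n (u n) + frag_cmul 2 y)"
    using singular_relboundary_add[OF b yb] by (simp add: algebra_simps)
  then show False
    using sphere_class_odd[OF u y] by blast
qed

section \<open>Unit vectors with the origin in their convex hull\<close>

definition dot :: "nat \<Rightarrow> (nat \<Rightarrow> real) \<Rightarrow> (nat \<Rightarrow> real) \<Rightarrow> real" where
  "dot m x y = (\<Sum>i\<le>m. x i * y i)"

text \<open>
  A second moment argument. Draw \<open>i\<close> and \<open>j\<close> independently with the weights \<open>l\<close>, and let \<open>t\<close> be the inner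
  product of \<open>u\<^sub>i\<close> and \<open>u\<^sub>j\<close>. If the combination vanished, \<open>t\<close> would have mean 0. Almost surely \<open>-c \<le> t \<le> 1\<close>,
  so \<open>(t + c)(1 - t) \<ge> 0\<close> and taking means shows that \<open>t\<^sup>2\<close> has mean at most \<open>c\<close>. But this mean is the
  squared Frobenius norm of the matrix \<open>M = \<Sum> l\<^sub>i u\<^sub>i u\<^sub>i\<^sup>T\<close> of size \<open>m + 1\<close> and trace 1, so it is at
  least \<open>1 / (m + 1)\<close>. The bound is sharp: for the vertices of a regular simplex with equal weights the
  combination is 0 and \<open>c = 1 / (m + 1)\<close>.
\<close>

lemma convex_combination_of_unit_vectors_nonzero:
  fixes u :: "'i \<Rightarrow> nat \<Rightarrow> real" and l :: "'i \<Rightarrow> real"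
  assumes "finite N" and l: "\<And>i. i \<in> N \<Longrightarrow> l i \<ge> 0" and l1: "sum l N = 1"
    and unit: "\<And>i. i \<in> N \<Longrightarrow> dot m (u i) (u i) = 1"
    and sep: "\<And>i j. i \<in> N \<Longrightarrow> j \<in> N \<Longrightarrow> l i > 0 \<Longrightarrow> l j > 0 \<Longrightarrow> dot m (u i) (u j) \<ge> - c"
    and c: "c < 1 / (real m + 1)"
  shows "\<exists>k\<le>m. (\<Sum>i\<in>N. l i * u i k) \<noteq> 0"
proof (rule ccontr)
  assume "\<not> ?thesis"
  then have zero: "(\<Sum>i\<in>N. l i * u i k) = 0" if "k \<le> m" for k
    using that by auto
  define t where "t i j = dot m (u i) (u j)" for i j
  define M where "M a b = (\<Sum>i\<in>N. l i * u i a * u i b)" for a b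
  have t_le: "t i j \<le> 1" if "i \<in> N" "j \<in> N" for i j
  proof -
    have "0 \<le> (\<Sum>k\<le>m. (u i k - u j k)\<^sup>2)" by (simp add: sum_nonneg)
    also have "\<dots> = dot m (u i) (u i) + dot m (u j) (u j) - 2 * t i j"
      unfolding t_def dot_def sum_distrib_left sum_subtractf[symmetric] sum.distrib[symmetric]
      by (intro sum.cong refl) (simp add: power2_eq_square algebra_simps)
    finally show ?thesis using unit that by simp
  qed
  have mean: "(\<Sum>i\<in>N. \<Sum>j\<in>N. l i * l j * t i j) = 0"
  proof -
    have "(\<Sum>k\<le>m. (\<Sum>i\<in>N. l i * u i k) * (\<Sum>j\<in>N. l j * u j k))
        = (\<Sum>k\<le>m. \<Sum>i\<in>N. \<Sum>j\<in>N. (l i * u i k) * (l j * u j k))"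
      by (simp only: sum_product)
    also have "\<dots> = (\<Sum>i\<in>N. \<Sum>k\<le>m. \<Sum>j\<in>N. (l i * u i k) * (l j * u j k))"
      by (rule sum.swap)
    also have "\<dots> = (\<Sum>i\<in>N. \<Sum>j\<in>N. \<Sum>k\<le>m. (l i * u i k) * (l j * u j k))"
      by (intro sum.cong refl sum.swap)
    also have "\<dots> = (\<Sum>i\<in>N. \<Sum>j\<in>N. l i * l j * t i j)"
      unfolding t_def dot_def sum_distrib_left by (intro sum.cong refl) (simp add: algebra_simps)
    finally show ?thesis by (simp add: zero)
  qed
  have total: "(\<Sum>i\<in>N. \<Sum>j\<in>N. l i * l j) = 1"
    using l1 by (simp add: sum_product[symmetric])
  have second: "(\<Sum>i\<in>N. \<Sum>j\<in>N. l i * l j * (t i j)\<^sup>2) = (\<Sum>a\<le>m. \<Sum>b\<le>m. (M a b)\<^sup>2)"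
  proof -
    have "(\<Sum>a\<le>m. \<Sum>b\<le>m. (M a b)\<^sup>2)
        = (\<Sum>a\<le>m. \<Sum>b\<le>m. \<Sum>i\<in>N. \<Sum>j\<in>N. l i * l j * (u i a * u j a) * (u i b * u j b))"
      unfolding M_def power2_eq_square sum_product
      by (intro sum.cong refl) (simp add: algebra_simps)
    also have "\<dots> = (\<Sum>i\<in>N. \<Sum>j\<in>N. \<Sum>a\<le>m. \<Sum>b\<le>m. l i * l j * (u i a * u j a) * (u i b * u j b))"
      (is "(\<Sum>a\<le>m. \<Sum>b\<le>m. \<Sum>i\<in>N. \<Sum>j\<in>N. ?s a b i j) = _")
    proof -
      have "(\<Sum>a\<le>m. \<Sum>b\<le>m. \<Sum>i\<in>N. \<Sum>j\<in>N. ?s a b i j)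
          = (\<Sum>a\<le>m. \<Sum>i\<in>N. \<Sum>b\<le>m. \<Sum>j\<in>N. ?s a b i j)"
        by (intro sum.cong refl sum.swap)
      also have "\<dots> = (\<Sum>i\<in>N. \<Sum>a\<le>m. \<Sum>j\<in>N. \<Sum>b\<le>m. ?s a b i j)"
        by (subst sum.swap, intro sum.cong refl sum.swap)
      also have "\<dots> = (\<Sum>i\<in>N. \<Sum>j\<in>N. \<Sum>a\<le>m. \<Sum>b\<le>m. ?s a b i j)"
        by (intro sum.cong refl sum.swap)
      finally show ?thesis .
    qed
    also have "\<dots> = (\<Sum>i\<in>N. \<Sum>j\<in>N. l i * l j * (t i j)\<^sup>2)"
      unfolding t_def dot_def power2_eq_square sum_product sum_distrib_left
      by (intro sum.cong refl) (simp add: sum_distrib_left algebra_simps)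
    finally show ?thesis by simp
  qed
  have "(\<Sum>i\<in>N. \<Sum>j\<in>N. l i * l j * ((t i j + c) * (1 - t i j))) \<ge> 0"
  proof (intro sum_nonneg)
    fix i j assume ij: "i \<in> N" "j \<in> N"
    show "0 \<le> l i * l j * ((t i j + c) * (1 - t i j))"
    proof (cases "l i > 0 \<and> l j > 0")
      case True
      then show ?thesis
        using sep[OF ij] t_le[OF ij] by (intro mult_nonneg_nonneg) (auto simp: t_def)
    next
      case False
      then have zero_weight: "l i * l j = 0" using l ij by force
      show ?thesis unfolding zero_weight by simp
    qed
  qed
  also have "(\<Sum>i\<in>N. \<Sum>j\<in>N. l i * l j * ((t i j + c) * (1 - t i j)))
     = (1 - c) * (\<Sum>i\<in>N. \<Sum>j\<in>N. l i * l j * t i j) + c * (\<Sum>i\<in>N. \<Sum>j\<in>N. l i * l j)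
       - (\<Sum>i\<in>N. \<Sum>j\<in>N. l i * l j * (t i j)\<^sup>2)"
    unfolding sum_distrib_left sum_subtractf[symmetric] sum.distrib[symmetric]
    by (intro sum.cong refl) (simp add: power2_eq_square algebra_simps)
  finally have upper: "(\<Sum>a\<le>m. \<Sum>b\<le>m. (M a b)\<^sup>2) \<le> c"
    by (simp add: mean total second)
  have trace: "(\<Sum>a\<le>m. M a a) = 1"
  proof -
    have "(\<Sum>a\<le>m. M a a) = (\<Sum>i\<in>N. l i * dot m (u i) (u i))"
      unfolding M_def dot_def sum_distrib_left by (subst sum.swap) (simp add: algebra_simps)
    also have "\<dots> = 1" using unit l1 by simp
    finally show ?thesis .
  qed
  have "1 = (\<Sum>a\<le>m. M a a)\<^sup>2" by (simp add: trace)
  also have "\<dots> \<le> (\<Sum>a\<le>m. (M a a)\<^sup>2) * (\<Sum>a\<le>m. 1\<^sup>2)"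
    using Cauchy_Schwarz_ineq_sum[of "\<lambda>a. M a a" "\<lambda>_. 1" "{..m}"] by simp
  also have "(\<Sum>a\<le>m. (M a a)\<^sup>2) * (\<Sum>a\<le>m. 1\<^sup>2) = (real m + 1) * (\<Sum>a\<le>m. (M a a)\<^sup>2)"
    by simp
  also have "\<dots> \<le> (real m + 1) * (\<Sum>a\<le>m. \<Sum>b\<le>m. (M a b)\<^sup>2)"
    by (intro mult_left_mono sum_mono member_le_sum) auto
  also have "\<dots> \<le> (real m + 1) * c"
    using upper by (intro mult_left_mono) auto
  also have "\<dots> < 1"
    using c by (simp add: field_simps)
  finally show False by simp
qed

section \<open>Odd maps without continuity\<close>

lemma nsphere_eq_top_of_set: "nsphere n = top_of_set (topspace (nsphere n))"
  by (simp add: nsphere euclidean_product_topology)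

lemma dot_self: "x \<in> topspace (nsphere n) \<Longrightarrow> dot n x x = 1"
  by (simp add: nsphere dot_def power2_eq_square)

lemma continuous_on_dot [continuous_intros]: "continuous_on A (\<lambda>x. dot n x y)"
  unfolding dot_def by (intro continuous_intros continuous_on_subset[OF continuous_on_product_coordinates]) auto

lemma compact_nsphere: "compact (topspace (nsphere n))"
proof -
  have "compact (PiE UNIV (\<lambda>_::nat. {-1..1::real}))"
    using compactin_PiE[of "\<lambda>_::nat. euclideanreal" UNIV "\<lambda>_. {-1..1}"]
    by (simp add: euclidean_product_topology)
  moreover have "topspace (nsphere n) \<subseteq> PiE UNIV (\<lambda>_::nat. {-1..1::real})"
    using topspace_nsphere_1[of _ n] by (auto simp: abs_square_le_1 abs_le_iff)
  moreover have "closed (topspace (nsphere n))"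
  proof -
    have "closed {x::nat\<Rightarrow>real. (\<Sum>i\<le>n. (x i)\<^sup>2) = 1 \<and> (\<forall>i. n < i \<longrightarrow> x i = 0)}"
      by (intro closed_Collect_conj closed_Collect_all closed_Collect_imp closed_Collect_eq open_Collect_const
          continuous_intros continuous_on_product_coordinates)
    then show ?thesis by (simp add: nsphere)
  qed
  ultimately show ?thesis
    by (metis compact_Int_closed inf.absorb2)
qed

text \<open>
  On the sphere \<open>1 - dot n a b\<close> is half the squared chordal distance, and
  \<open>\<parallel>x - y\<parallel>\<^sup>2 \<le> 2 \<parallel>x - z\<parallel>\<^sup>2 + 2 \<parallel>z - y\<parallel>\<^sup>2\<close>; this is where the factor 4 comes from.
\<close>

lemma dot_close:
  assumes "x \<in> topspace (nsphere n)" "y \<in> topspace (nsphere n)" "z \<in> topspace (nsphere n)"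
    and "dot n z x \<ge> 1 - e" "dot n z y \<ge> 1 - e"
  shows "dot n x y \<ge> 1 - 4 * e"
proof -
  have sq: "(\<Sum>i\<le>n. (a i - b i)\<^sup>2) = 2 - 2 * dot n a b" if "a \<in> topspace (nsphere n)" "b \<in> topspace (nsphere n)" for a b
  proof -
    have "(\<Sum>i\<le>n. (a i - b i)\<^sup>2) = dot n a a + dot n b b - 2 * dot n a b"
      unfolding dot_def sum_distrib_left sum_subtractf[symmetric] sum.distrib[symmetric]
      by (intro sum.cong refl) (simp add: power2_eq_square algebra_simps)
    then show ?thesis using that by (simp add: dot_self)
  qed
  have "(\<Sum>i\<le>n. (x i - y i)\<^sup>2) \<le> (\<Sum>i\<le>n. 2 * (z i - x i)\<^sup>2 + 2 * (z i - y i)\<^sup>2)"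
  proof (intro sum_mono)
    fix i
    have "0 \<le> ((z i - x i) + (z i - y i))\<^sup>2" by simp
    then show "(x i - y i)\<^sup>2 \<le> 2 * (z i - x i)\<^sup>2 + 2 * (z i - y i)\<^sup>2"
      by (simp add: power2_eq_square algebra_simps)
  qed
  also have "\<dots> = 2 * (2 - 2 * dot n z x) + 2 * (2 - 2 * dot n z y)"
    using assms by (simp add: sum.distrib sum_distrib_left[symmetric] sq)
  finally show ?thesis using assms sq[of x y] by simp
qed

lemma finite_symmetric_net:
  assumes "e > 0"
  obtains N where "finite N" "N \<subseteq> topspace (nsphere n)" "antipode ` N = N"
    "\<And>x. x \<in> topspace (nsphere n) \<Longrightarrow> \<exists>i\<in>N. dot n x i > 1 - e"
proof -
  let ?S = "topspace (nsphere n)"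
  obtain C where C: "C \<subseteq> ?S" "finite C" "?S \<subseteq> (\<Union>i\<in>C. {x. dot n x i > 1 - e})"
  proof (rule compactE_image[OF compact_nsphere])
    show "open {x. dot n x i > 1 - e}" for i
      by (intro open_Collect_less continuous_intros)
    show "?S \<subseteq> (\<Union>i\<in>?S. {x. dot n x i > 1 - e})"
      using assms by (auto simp: dot_self intro!: bexI)
  qed
  show thesis
  proof (rule that[of "C \<union> antipode ` C"])
    show "antipode ` (C \<union> antipode ` C) = C \<union> antipode ` C"
      by (auto simp: image_Un image_comp)
    show "\<exists>i\<in>C \<union> antipode ` C. dot n x i > 1 - e" if "x \<in> ?S" for x
      using C(3) that by blast
  qed (use C antipode_in_nsphere in auto)
qed

text \<open>
  A possibly discontinuous odd map to the sphere one dimension lower must send some pairs of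
  arbitrarily close points almost as far apart as two vertices of an inscribed regular simplex.
  Otherwise average \<open>f\<close> over the points near \<open>x\<close> of a fine finite net, with weights that depend
  continuously on \<open>x\<close>. The averages do not vanish, by \<open>convex_combination_of_unit_vectors_nonzero\<close>, and
  they depend oddly on \<open>x\<close> because the net is symmetric. Normalising them contradicts the Borsuk-Ulam
  theorem.
\<close>

theorem Dubins_Schwarz:
  assumes fS: "\<And>x. x \<in> topspace (nsphere (Suc m)) \<Longrightarrow> f x \<in> topspace (nsphere m)"
    and odd: "\<And>x. x \<in> topspace (nsphere (Suc m)) \<Longrightarrow> f (antipode x) = antipode (f x)"
    and "\<delta> > 0" and c: "c < 1 / (real m + 1)"
    and near: "\<And>x y. x \<in> topspace (nsphere (Suc m)) \<Longrightarrow> y \<in> topspace (nsphere (Suc m)) \<Longrightarrow>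
        dot (Suc m) x y \<ge> 1 - \<delta> \<Longrightarrow> dot m (f x) (f y) \<ge> - c"
  shows False
proof -
  let ?S = "topspace (nsphere (Suc m))"
  define e where "e = \<delta> / 4"
  have "e > 0" using \<open>\<delta> > 0\<close> by (simp add: e_def)
  then obtain N where N: "finite N" "N \<subseteq> ?S" "antipode ` N = N"
    and net: "\<And>x. x \<in> ?S \<Longrightarrow> \<exists>i\<in>N. dot (Suc m) x i > 1 - e"
    by (rule finite_symmetric_net[of e "Suc m"]) blast
  define w where "w x i = max 0 (dot (Suc m) x i - (1 - e))" for x i
  define F where "F x k = (\<Sum>i\<in>N. w x i * f i k)" for x k
  define r where "r x = sqrt (\<Sum>k\<le>m. (F x k)\<^sup>2)" for x
  have F_pos: "r x > 0" if x: "x \<in> ?S" for x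
  proof -
    define W where "W = (\<Sum>i\<in>N. w x i)"
    have w0: "w x i \<ge> 0" for i by (simp add: w_def)
    obtain i where "i \<in> N" "dot (Suc m) x i > 1 - e" using net[OF x] by blast
    then have "W > 0"
      unfolding W_def using N(1) w0 by (intro sum_pos2[of N i]) (auto simp: w_def)
    have "\<exists>k\<le>m. (\<Sum>i\<in>N. (w x i / W) * f i k) \<noteq> 0"
    proof (rule convex_combination_of_unit_vectors_nonzero[OF N(1) _ _ _ _ c])
      show "w x i / W \<ge> 0" for i using w0 \<open>W > 0\<close> by simp
      show "(\<Sum>i\<in>N. w x i / W) = 1" using \<open>W > 0\<close> by (simp add: sum_divide_distrib[symmetric] W_def)
      show "dot m (f i) (f i) = 1" if "i \<in> N" for i using that N(2) fS by (blast intro: dot_self)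
      show "- c \<le> dot m (f i) (f j)" if ij: "i \<in> N" "j \<in> N" and pos: "0 < w x i / W" "0 < w x j / W" for i j
      proof -
        have "dot (Suc m) x i \<ge> 1 - e" "dot (Suc m) x j \<ge> 1 - e"
          using pos \<open>W > 0\<close> by (auto simp: w_def zero_less_divide_iff split: if_splits)
        then have "dot (Suc m) i j \<ge> 1 - \<delta>"
          using dot_close[of i "Suc m" j x e] ij N(2) x by (auto simp: e_def)
        then show ?thesis using near ij N(2) by blast
      qed
    qed
    then obtain k where k: "k \<le> m" "(\<Sum>i\<in>N. (w x i / W) * f i k) \<noteq> 0" by blast
    have "(\<Sum>i\<in>N. (w x i / W) * f i k) = F x k / W"
      by (simp add: F_def sum_divide_distrib)
    then have "F x k \<noteq> 0" using k by auto
    then have "(\<Sum>k\<le>m. (F x k)\<^sup>2) > 0"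
      using k(1) by (intro sum_pos2[of "{..m}" k]) auto
    then show ?thesis by (simp add: r_def)
  qed
  have F_odd: "F (antipode x) k = - F x k" for x k
  proof -
    have inj: "inj_on antipode N" by (auto simp: inj_on_def antipode_def fun_eq_iff)
    have "F (antipode x) k = (\<Sum>i\<in>N. w (antipode x) (antipode i) * f (antipode i) k)"
      unfolding F_def by (subst N(3)[symmetric]) (simp add: sum.reindex[OF inj])
    also have "\<dots> = (\<Sum>i\<in>N. - (w x i * f i k))"
    proof (intro sum.cong refl)
      fix i assume "i \<in> N"
      then have "f (antipode i) k = - f i k" using odd N(2) by (auto simp: antipode_def)
      then show "w (antipode x) (antipode i) * f (antipode i) k = - (w x i * f i k)"
        by (simp add: w_def dot_def antipode_def)
    qed
    finally show ?thesis by (simp add: F_def sum_negf)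
  qed
  define G where "G x k = F x k / r x" for x k
  have "G x \<in> topspace (nsphere m)" if x: "x \<in> ?S" for x
  proof -
    have "(\<Sum>k\<le>m. (G x k)\<^sup>2) = (\<Sum>k\<le>m. (F x k)\<^sup>2) / (r x)\<^sup>2"
      by (simp add: G_def power_divide sum_divide_distrib)
    also have "(r x)\<^sup>2 = (\<Sum>k\<le>m. (F x k)\<^sup>2)"
      unfolding r_def by (intro real_sqrt_pow2 sum_nonneg) auto
    finally have "(\<Sum>k\<le>m. (G x k)\<^sup>2) = 1" using F_pos[OF x] by (auto simp: r_def)
    moreover have "G x k = 0" if "k > m" for k
    proof -
      have "f i k = 0" if "i \<in> N" for i
        using fS[of i] N(2) that \<open>k > m\<close> by (auto simp: nsphere)
      then show ?thesis by (simp add: G_def F_def)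
    qed
    ultimately show ?thesis by (simp add: nsphere)
  qed
  moreover have "continuous_on ?S G"
  proof (rule continuous_on_coordinatewise_then_product)
    fix k
    have cF: "continuous_on ?S (\<lambda>x. F x k)" for k
      unfolding F_def w_def by (intro continuous_intros)
    have "r x \<noteq> 0" if "x \<in> ?S" for x using F_pos[OF that] by simp
    moreover have "continuous_on ?S r"
      unfolding r_def by (intro continuous_intros cF)
    ultimately show "continuous_on ?S (\<lambda>x. G x k)"
      unfolding G_def by (intro continuous_intros cF) auto
  qed
  ultimately have "continuous_map (nsphere (Suc m)) (nsphere m) G"
    using nsphere_eq_top_of_set by (metis continuous_map_subtopology_eu image_subsetI image_subset_iff_funcset)
  moreover have "G (antipode x) = antipode (G x)" for x
  proof -
    have "r (antipode x) = r x" by (simp add: r_def F_odd)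
    then have "G (antipode x) k = - G x k" for k by (simp add: G_def F_odd)
    then show ?thesis by (simp add: antipode_def fun_eq_iff)
  qed
  ultimately show False by (rule Borsuk_Ulam)
qed

section \<open>Distortion of maps between spheres\<close>

lemma geodesic_dist_dot: "geodesic_dist n x y = arccos (dot n x y)"
  by (simp add: geodesic_dist_def dot_def)

lemma dot_bounds:
  assumes "x \<in> topspace (nsphere n)" "y \<in> topspace (nsphere n)"
  shows "- 1 \<le> dot n x y" "dot n x y \<le> 1"
proof -
  have "(dot n x y)\<^sup>2 \<le> dot n x x * dot n y y"
    using Cauchy_Schwarz_ineq_sum[of x y "{..n}"] by (simp add: dot_def power2_eq_square)
  then have "\<bar>dot n x y\<bar> \<le> 1"
    using assms by (simp add: dot_self abs_square_le_1)
  then show "- 1 \<le> dot n x y" "dot n x y \<le> 1" by auto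
qed

lemma geodesic_dist_antipode:
  assumes "x \<in> topspace (nsphere n)" "y \<in> topspace (nsphere n)"
  shows "geodesic_dist n (antipode x) y = pi - geodesic_dist n x y"
    and "geodesic_dist n x (antipode y) = pi - geodesic_dist n x y"
proof -
  have "dot n (antipode x) y = - dot n x y" "dot n x (antipode y) = - dot n x y"
    by (simp_all add: dot_def antipode_def sum_negf)
  then show "geodesic_dist n (antipode x) y = pi - geodesic_dist n x y"
    "geodesic_dist n x (antipode y) = pi - geodesic_dist n x y"
    using dot_bounds[OF assms] by (simp_all add: geodesic_dist_dot arccos_minus)
qed

text \<open>
  For nearby points, a distance close to 0 in the domain becomes a distance of at most slightly more
  than the distortion bound \<open>D\<close> in the target. If \<open>D\<close> were below \<open>zeta m\<close>, this would contradict
  \<open>Dubins_Schwarz\<close>, as \<open>zeta m\<close> is the angle between two vertices of an inscribed regular simplex.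
\<close>

lemma odd_map_distortion:
  assumes fS: "\<And>x. x \<in> topspace (nsphere (Suc m)) \<Longrightarrow> f x \<in> topspace (nsphere m)"
    and odd: "\<And>x. x \<in> topspace (nsphere (Suc m)) \<Longrightarrow> f (antipode x) = antipode (f x)"
    and dis: "\<And>x y. x \<in> topspace (nsphere (Suc m)) \<Longrightarrow> y \<in> topspace (nsphere (Suc m)) \<Longrightarrow>
        \<bar>geodesic_dist (Suc m) x y - geodesic_dist m (f x) (f y)\<bar> \<le> D"
  shows "zeta m \<le> D"
proof (rule ccontr)
  assume "\<not> zeta m \<le> D"
  \<comment> \<open>Half of the gap between \<open>D\<close> and \<open>zeta m\<close>, cut off where the cosine stops decreasing.\<close>
  define h where "h = min pi ((zeta m - D) / 2)"
  have D: "0 \<le> D" using dis[OF in_topspace_nsphere in_topspace_nsphere] by linarith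
  have neg: "- 1 \<le> - 1 / (real m + 1)" "- 1 / (real m + 1) \<le> 1" by (simp_all add: field_simps)
  then have zeta: "0 \<le> zeta m" "zeta m \<le> pi" "cos (zeta m) = - 1 / (real m + 1)"
    unfolding zeta_def by (auto intro: arccos_lbound arccos_ubound cos_arccos)
  have h: "0 < h" "h \<le> pi" "D + h < zeta m"
    using \<open>\<not> zeta m \<le> D\<close> by (auto simp: h_def min_def field_simps)
  show False
  proof (rule Dubins_Schwarz[of m f "1 - cos h" "- cos (D + h)"])
    have "cos h < cos 0" using h by (intro cos_monotone_0_pi) auto
    then show "0 < 1 - cos h" by simp
    have "cos (zeta m) < cos (D + h)" using D h zeta by (intro cos_monotone_0_pi) auto
    then show "- cos (D + h) < 1 / (real m + 1)" using zeta by simp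
  next
    fix x y assume x: "x \<in> topspace (nsphere (Suc m))" and y: "y \<in> topspace (nsphere (Suc m))"
      and "1 - (1 - cos h) \<le> dot (Suc m) x y"
    then have "arccos (dot (Suc m) x y) \<le> arccos (cos h)"
      using dot_bounds[OF x y] by (intro arccos_le_arccos) auto
    then have "geodesic_dist (Suc m) x y \<le> h"
      using h by (simp add: geodesic_dist_dot arccos_cos)
    then have "arccos (dot m (f x) (f y)) \<le> D + h"
      using dis[OF x y] by (simp add: geodesic_dist_dot)
    moreover note b = dot_bounds[OF fS[OF x] fS[OF y]]
    ultimately have "cos (D + h) \<le> cos (arccos (dot m (f x) (f y)))"
      using D h zeta by (intro cos_monotone_0_pi_le arccos_lbound) auto
    then show "- (- cos (D + h)) \<le> dot m (f x) (f y)"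
      using b by (simp add: cos_arccos)
  qed (use fS odd in auto)
qed

text \<open>
  On a sphere this selects exactly one point from every antipodal pair, and always a point of the
  closed upper hemisphere; on the equator the choice is made by the lower coordinates.
\<close>

definition last_nonzero_positive :: "(nat \<Rightarrow> real) \<Rightarrow> bool" where
  "last_nonzero_positive x \<longleftrightarrow> (\<exists>k. x k > 0 \<and> (\<forall>j>k. x j = 0))"

lemma last_nonzero_positive_antipode:
  assumes x: "x \<in> topspace (nsphere n)"
  shows "last_nonzero_positive (antipode x) \<longleftrightarrow> \<not> last_nonzero_positive x"
proof
  assume "last_nonzero_positive (antipode x)"
  then obtain k where k: "x k < 0" "\<And>j. j > k \<Longrightarrow> x j = 0"
    by (auto simp: last_nonzero_positive_def antipode_def)
  show "\<not> last_nonzero_positive x"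
  proof
    assume "last_nonzero_positive x"
    then obtain k' where "x k' > 0" "\<And>j. j > k' \<Longrightarrow> x j = 0"
      by (auto simp: last_nonzero_positive_def)
    then show False using k by (cases k k' rule: linorder_cases) force+
  qed
next
  assume not_pos: "\<not> last_nonzero_positive x"
  have fin: "{k. x k \<noteq> 0} \<subseteq> {..n}" using x by (auto simp: nsphere not_less[symmetric])
  have "{k. x k \<noteq> 0} \<noteq> {}"
  proof
    assume "{k. x k \<noteq> 0} = {}"
    then have "(\<Sum>i\<le>n. (x i)\<^sup>2) = 0" by simp
    then show False using x by (simp add: nsphere)
  qed
  define k where "k = Max {k. x k \<noteq> 0}"
  have f: "finite {k. x k \<noteq> 0}" using fin finite_subset by blast
  have "x k \<noteq> 0" using Max_in[OF f] \<open>{k. x k \<noteq> 0} \<noteq> {}\<close> by (simp add: k_def)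
  moreover have above: "x j = 0" if "j > k" for j
    using Max_ge[OF f, of j] that by (force simp: k_def)
  moreover have "\<not> x k > 0"
    using not_pos above by (auto simp: last_nonzero_positive_def)
  ultimately have "x k < 0" by simp
  then show "last_nonzero_positive (antipode x)"
    using above by (auto simp: last_nonzero_positive_def antipode_def)
qed

lemma last_nonzero_positive_upper:
  assumes "x \<in> topspace (nsphere n)" "last_nonzero_positive x"
  shows "x \<in> upper_hemisphere n"
proof -
  obtain k where k: "x k > 0" "\<And>j. j > k \<Longrightarrow> x j = 0"
    using assms(2) by (auto simp: last_nonzero_positive_def)
  have "x n \<ge> 0" using k by (cases k n rule: linorder_cases) (use assms(1) in \<open>auto simp: nsphere\<close>)
  then show ?thesis using assms(1) by (simp add: upper_hemisphere_def)
qed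

text \<open>
  Keep the values of \<open>f\<close> on one point of every antipodal pair and extend them to an odd map of the whole
  sphere. This does not increase the distortion: replacing a point by its antipode turns a spherical
  distance \<open>d\<close> into \<open>\<pi> - d\<close>, in the domain and in the target alike, so differences of distances keep
  their absolute value.
\<close>

theorem hemisphere_map_distortion:
  assumes fS: "\<And>x. x \<in> upper_hemisphere (Suc m) \<Longrightarrow> f x \<in> topspace (nsphere m)"
    and dis: "\<And>x y. x \<in> upper_hemisphere (Suc m) \<Longrightarrow> y \<in> upper_hemisphere (Suc m) \<Longrightarrow>
        \<bar>geodesic_dist (Suc m) x y - geodesic_dist m (f x) (f y)\<bar> \<le> D"
  shows "zeta m \<le> D"
proof -
  let ?S = "topspace (nsphere (Suc m))"
  define g where "g x = (if last_nonzero_positive x then f x else antipode (f (antipode x)))" for x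
  have twice: "antipode (antipode x) = x" for x by (simp add: antipode_def)
  have cases: "last_nonzero_positive x \<and> x \<in> upper_hemisphere (Suc m)
      \<or> \<not> last_nonzero_positive x \<and> antipode x \<in> upper_hemisphere (Suc m)" if "x \<in> ?S" for x
    using that last_nonzero_positive_upper last_nonzero_positive_antipode antipode_in_nsphere by blast
  show ?thesis
  proof (rule odd_map_distortion[of m g])
    fix x assume x: "x \<in> ?S"
    show "g x \<in> topspace (nsphere m)"
      using cases[OF x] fS by (auto simp: g_def antipode_in_nsphere)
    show "g (antipode x) = antipode (g x)"
      using last_nonzero_positive_antipode[OF x] by (simp add: g_def twice)
  next
    fix x y assume x: "x \<in> ?S" and y: "y \<in> ?S"
    have flip: "\<bar>geodesic_dist (Suc m) a b - geodesic_dist m c d\<bar>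
        = \<bar>geodesic_dist (Suc m) (antipode a) b - geodesic_dist m (antipode c) d\<bar>"
      "\<bar>geodesic_dist (Suc m) a b - geodesic_dist m c d\<bar>
        = \<bar>geodesic_dist (Suc m) a (antipode b) - geodesic_dist m c (antipode d)\<bar>"
      if "a \<in> ?S" "b \<in> ?S" "c \<in> topspace (nsphere m)" "d \<in> topspace (nsphere m)" for a b c d
      using that by (simp_all add: geodesic_dist_antipode)
    define x' where "x' = (if last_nonzero_positive x then x else antipode x)"
    define y' where "y' = (if last_nonzero_positive y then y else antipode y)"
    have x': "x' \<in> upper_hemisphere (Suc m)" and y': "y' \<in> upper_hemisphere (Suc m)"
      using cases[OF x] cases[OF y] by (auto simp: x'_def y'_def)
    then have S: "x' \<in> ?S" "y' \<in> ?S" "antipode y' \<in> ?S" "f x' \<in> topspace (nsphere m)" "f y' \<in> topspace (nsphere m)"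
       "antipode (f y') \<in> topspace (nsphere m)"
      using fS by (auto simp: upper_hemisphere_def antipode_in_nsphere)
    have gx: "x = x' \<and> g x = f x' \<or> x = antipode x' \<and> g x = antipode (f x')"
      by (simp add: g_def x'_def twice)
    have gy: "y = y' \<and> g y = f y' \<or> y = antipode y' \<and> g y = antipode (f y')"
      by (simp add: g_def y'_def twice)
    have "\<bar>geodesic_dist (Suc m) x y - geodesic_dist m (g x) (g y)\<bar>
        = \<bar>geodesic_dist (Suc m) x' y' - geodesic_dist m (f x') (f y')\<bar>"
      using gx gy flip(1)[of x' y' "f x'" "f y'"] flip(2)[of x' y' "f x'" "f y'"]
        flip(1)[of x' "antipode y'" "f x'" "antipode (f y')"] S by auto
    then show "\<bar>geodesic_dist (Suc m) x y - geodesic_dist m (g x) (g y)\<bar> \<le> D"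
      using dis[OF x' y'] by simp
  qed
qed

section \<open>Hausdorff distance and distortion\<close>

lemma map_distortion_ge_zeta:
  assumes f: "isometric_embedding X dX (topspace (nsphere m)) (geodesic_dist m) f"
    and g: "isometric_embedding (upper_hemisphere (Suc m)) (geodesic_dist (Suc m)) Y dY g"
    and \<phi>: "\<phi> ` Y \<subseteq> X"
  shows "ennreal (zeta m) \<le> map_distortion Y dY dX \<phi>"
proof (cases "map_distortion Y dY dX \<phi>" rule: ennreal_cases)
  case (real D)
  have le: "\<bar>dY y y' - dX (\<phi> y) (\<phi> y')\<bar> \<le> D" if "y \<in> Y" "y' \<in> Y" for y y'
  proof -
    have "ennreal \<bar>dY y y' - dX (\<phi> y) (\<phi> y')\<bar> \<le> map_distortion Y dY dX \<phi>"
      unfolding map_distortion_def using that by (intro SUP_upper2[of y] SUP_upper2[of y']) auto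
    then show ?thesis using real by (simp add: ennreal_le_iff)
  qed
  have "zeta m \<le> D"
  proof (rule hemisphere_map_distortion[of m "\<lambda>x. f (\<phi> (g x))"])
    fix x assume x: "x \<in> upper_hemisphere (Suc m)"
    then have gx: "g x \<in> Y" using g by (auto simp: isometric_embedding_def)
    then show "f (\<phi> (g x)) \<in> topspace (nsphere m)"
      using f \<phi> by (auto simp: isometric_embedding_def)
    fix y assume y: "y \<in> upper_hemisphere (Suc m)"
    then have gy: "g y \<in> Y" using g by (auto simp: isometric_embedding_def)
    have "dY (g x) (g y) = geodesic_dist (Suc m) x y"
      using g x y by (simp add: isometric_embedding_def)
    moreover have "geodesic_dist m (f (\<phi> (g x))) (f (\<phi> (g y))) = dX (\<phi> (g x)) (\<phi> (g y))"
      using f \<phi> gx gy by (simp add: isometric_embedding_def image_subset_iff)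
    ultimately show "\<bar>geodesic_dist (Suc m) x y - geodesic_dist m (f (\<phi> (g x))) (f (\<phi> (g y)))\<bar> \<le> D"
      using le[OF gx gy] by simp
  qed
  then show ?thesis using real by (simp add: ennreal_leI)
qed simp

text \<open>
  Send every \<open>y\<close> to some \<open>x\<close> whose image in the ambient space is less than \<open>r\<close> away from that of \<open>y\<close>. This
  moves two points, each by less than \<open>r\<close>, and so changes their distance by at most \<open>2 r\<close>.
\<close>

lemma map_distortion_le_hausdorff_dist:
  assumes Z: "Metric_space Z dZ"
    and f: "isometric_embedding X dX Z dZ f" and g: "isometric_embedding Y dY Z dZ g"
    and r: "hausdorff_dist dZ (f ` X) (g ` Y) < ennreal r"
  obtains \<phi> where "\<phi> ` Y \<subseteq> X" "map_distortion Y dY dX \<phi> \<le> ennreal (2 * r)"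
proof -
  interpret Metric_space Z dZ by (rule Z)
  have "\<exists>x\<in>X. dZ (f x) (g y) < r" if y: "y \<in> Y" for y
  proof -
    have "(INF a\<in>f ` X. ennreal (dZ a (g y))) \<le> (SUP b\<in>g ` Y. INF a\<in>f ` X. ennreal (dZ a b))"
      using y by (intro SUP_upper) auto
    also have "\<dots> \<le> hausdorff_dist dZ (f ` X) (g ` Y)"
      by (simp add: hausdorff_dist_def)
    also note r
    finally obtain x where x: "x \<in> X" "ennreal (dZ (f x) (g y)) < ennreal r"
      by (auto simp: INF_less_iff)
    then show ?thesis using ennreal_less_iff[OF nonneg] by blast
  qed
  then obtain \<phi> where \<phi>: "\<And>y. y \<in> Y \<Longrightarrow> \<phi> y \<in> X \<and> dZ (f (\<phi> y)) (g y) < r"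
    by metis
  show thesis
  proof (rule that[of \<phi>])
    show "\<phi> ` Y \<subseteq> X" using \<phi> by auto
    show "map_distortion Y dY dX \<phi> \<le> ennreal (2 * r)"
      unfolding map_distortion_def
    proof (intro SUP_least ennreal_leI)
      fix y y' assume y: "y \<in> Y" and y': "y' \<in> Y"
      have in_Z: "g y \<in> Z" "g y' \<in> Z" "f (\<phi> y) \<in> Z" "f (\<phi> y') \<in> Z"
        using f g y y' \<phi> by (auto simp: isometric_embedding_def)
      have "dY y y' = dZ (g y) (g y')" "dX (\<phi> y) (\<phi> y') = dZ (f (\<phi> y)) (f (\<phi> y'))"
        using f g y y' \<phi> by (simp_all add: isometric_embedding_def)
      moreover have "dZ (g y) (g y') \<le> dZ (g y) (f (\<phi> y)) + dZ (f (\<phi> y)) (f (\<phi> y')) + dZ (f (\<phi> y')) (g y')"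
        using triangle[of "g y" "f (\<phi> y)" "g y'"] triangle[of "f (\<phi> y)" "f (\<phi> y')" "g y'"] in_Z by simp
      moreover have "dZ (f (\<phi> y)) (f (\<phi> y')) \<le> dZ (f (\<phi> y)) (g y) + dZ (g y) (g y') + dZ (g y') (f (\<phi> y'))"
        using triangle[of "f (\<phi> y)" "g y" "f (\<phi> y')"] triangle[of "g y" "g y'" "f (\<phi> y')"] in_Z by simp
      ultimately show "\<bar>dY y y' - dX (\<phi> y) (\<phi> y')\<bar> \<le> 2 * r"
        using \<phi>[OF y] \<phi>[OF y'] commute[of "g y" "f (\<phi> y)"] commute[of "g y'" "f (\<phi> y')"] by linarith
    qed
  qed
qed

theorem theorem3:
  fixes X :: "'a set" and dX :: "'a \<Rightarrow> 'a \<Rightarrow> real"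
    and Y :: "'b set" and dY :: "'b \<Rightarrow> 'b \<Rightarrow> real"
    and m :: nat
  assumes "Metric_space X dX" and "Metric_space.mbounded X dX X"
    and "Metric_space Y dY" and "Metric_space.mbounded Y dY Y"
    and "m > 0"
    and "\<exists>f. isometric_embedding X dX (topspace (nsphere m)) (geodesic_dist m) f"
    and "\<exists>g. isometric_embedding (upper_hemisphere (m + 1)) (geodesic_dist (m + 1)) Y dY g"
  shows "gromov_hausdorff_dist X dX Y dY \<ge> ennreal (zeta m / 2) \<and>
    (\<forall>\<phi>. \<phi> ` Y \<subseteq> X \<longrightarrow> map_distortion Y dY dX \<phi> \<ge> ennreal (zeta m))"
proof
  have dis: "map_distortion Y dY dX \<phi> \<ge> ennreal (zeta m)" if "\<phi> ` Y \<subseteq> X" for \<phi>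
    using assms(6,7) that map_distortion_ge_zeta by (metis Suc_eq_plus1)
  then show "\<forall>\<phi>. \<phi> ` Y \<subseteq> X \<longrightarrow> map_distortion Y dY dX \<phi> \<ge> ennreal (zeta m)" by blast
  show "gromov_hausdorff_dist X dX Y dY \<ge> ennreal (zeta m / 2)"
    unfolding gromov_hausdorff_dist_def
  proof (rule Inf_greatest, clarify)
    fix Z :: "('a + 'b) set" and dZ f g
    assume emb: "Metric_space Z dZ" "isometric_embedding X dX Z dZ f" "isometric_embedding Y dY Z dZ g"
    show "ennreal (zeta m / 2) \<le> hausdorff_dist dZ (f ` X) (g ` Y)"
    proof (rule ccontr)
      assume "\<not> ?thesis"
      then have "hausdorff_dist dZ (f ` X) (g ` Y) < ennreal (zeta m / 2)" by simp
      \<comment> \<open>A value strictly in between is finite, and it can serve as the radius \<open>r\<close>.\<close>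
      then obtain s where s: "hausdorff_dist dZ (f ` X) (g ` Y) < s" "s < ennreal (zeta m / 2)"
        using dense by blast
      then obtain r where r: "0 \<le> r" "s = ennreal r"
        by (cases s rule: ennreal_cases) auto
      then have "2 * r < zeta m" using s(2) by (simp add: ennreal_less_iff)
      obtain \<phi> where "\<phi> ` Y \<subseteq> X" "map_distortion Y dY dX \<phi> \<le> ennreal (2 * r)"
        using map_distortion_le_hausdorff_dist[OF emb] s(1) r(2) by metis
      then have "ennreal (zeta m) \<le> ennreal (2 * r)"
        using dis order_trans by blast
      then show False
        using r \<open>2 * r < zeta m\<close> by (simp add: ennreal_le_iff)
    qed
  qed
qed

end
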